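(* Let $D_S$ be a digraph with self-loops of order $n$ with $\sigma$ self-loops. Let $D_1,\dots,D_k$ be its strong components, where $D_i$ has order $n_i$ and $\sigma_i$ self-loops, such that $n=\sum_{i=1}^k n_i$ and $\sigma=\sum_{i=1}^k\sigma_i$, and let $\lambda_{i,1},\dots,\lambda_{i,n_i}$ be the eigenvalues of $A(D_i)$. Let $1\le l<k$ and suppose that $\frac{\sigma_i}{n_i}>\frac{\sigma}{n}$ for $i=1,\dots,l$ and $\frac{\sigma_i}{n_i}\le\frac{\sigma}{n}$ for $i=l+1,\dots,k$. For each $i$ let $$B_i=\left\{j\in\{1,\dots,n_i\}:\Re(\lambda_{i,j})>\frac{\sigma_i}{n_i}\right\}.$$ Then $$E(D_S)\le\sum_{i=1}^kE(D_i)\quad\Longrightarrow\quad\sum_{i=1}^l\left(\frac{\sigma_i}{n_i}-\frac{\sigma}{n}\right)|B_i|\le\sum_{i=l+1}^k\left(\frac{\sigma}{n}-\frac{\sigma_i}{n_i}\right)|B_i|.$$ If the inequality on the left-hand side of the implication is strict, then the inequality on the right-hand side is also strict.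
   Context: A digraph with self-loops $D_S$ is a pair $(V,\mathcal A)$ with $V$ a nonempty finite vertex set and $\mathcal A\subseteq V\times V$ a set of arcs; $S=\{v\in V:(v,v)\in\mathcal A\}$ is the self-loop set (possibly empty). The order is $n=|V|$ and the number of self-loops is $\sigma=|S|$. The adjacency matrix $A(D_S)=(a_{ij})$ has $a_{ij}=1$ if $(v_i,v_j)\in\mathcal A$ and $a_{ij}=0$ otherwise; eigenvalues are counted with algebraic multiplicity. The energy of a digraph with self-loops of order $n$ with $\sigma$ self-loops and eigenvalues $\lambda_1,\dots,\lambda_n$ is $\sum_{i=1}^n\left|\Re(\lambda_i)-\frac{\sigma}{n}\right|$; in particular $E(D_i)=\sum_{j=1}^{n_i}\left|\Re(\lambda_{i,j})-\frac{\sigma_i}{n_i}\right|$. A digraph is strongly connected if for any two distinct vertices $v,w$ there is a path from $v$ to $w$ and one from $w$ to $v$; a strong component is a maximal strongly connected sub-digraph (self-loops included). *)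

theory Defs
  imports
    Graph_Theory.Pair_Digraph
    Graph_Theory.Digraph_Component
    Jordan_Normal_Form.Char_Poly
    "HOL-Computational_Algebra.Fundamental_Theorem_Algebra"
begin

definition self_loop_set :: "'a pair_pre_digraph \<Rightarrow> 'a set" where
  "self_loop_set D = {v \<in> pverts D. (v, v) \<in> parcs D}"

definition enumerates :: "'a list \<Rightarrow> 'a pair_pre_digraph \<Rightarrow> bool" where
  "enumerates vs D \<longleftrightarrow> distinct vs \<and> set vs = pverts D"

text \<open>The entries are taken in the complex numbers because the spectrum is.\<close>

definition adjacency_matrix :: "'a list \<Rightarrow> 'a pair_pre_digraph \<Rightarrow> complex mat" where
  "adjacency_matrix vs D =
     mat (length vs) (length vs) (\<lambda>(i, j). if (vs ! i, vs ! j) \<in> parcs D then 1 else 0)"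

text \<open>The eigenvalues with algebraic multiplicity, as the multiset of roots of the characteristic
  polynomial. An arbitrary enumeration of the vertices is chosen; by \<open>eigenvalues_eq\<close>
  below the choice is irrelevant.\<close>

definition eigenvalues :: "'a pair_pre_digraph \<Rightarrow> complex multiset" where
  "eigenvalues D = proots (char_poly (adjacency_matrix (SOME vs. enumerates vs D) D))"

definition energy :: "'a pair_pre_digraph \<Rightarrow> real" where
  "energy D = (\<Sum>z\<in>#eigenvalues D.
     \<bar>Re z - real (card (self_loop_set D)) / real (card (pverts D))\<bar>)"

lemma det_permute_rows_cols:
  fixes B :: "'b :: comm_ring_1 mat"
  assumes B: "B \<in> carrier_mat n n" and p: "p permutes {0..<n}"
  shows "det (mat n n (\<lambda>(i, j). B $$ (p i, p j))) = det B"
proof -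
  define N where "N = mat n n (\<lambda>(i, j). B $$ (i, p j))"
  have pn: "p i < n" if "i < n" for i
    using permutes_in_image[OF p, of i] that by simp
  have N: "N \<in> carrier_mat n n" by (simp add: N_def)
  have "mat n n (\<lambda>(i, j). B $$ (p i, p j)) = mat n n (\<lambda>(i, j). N $$ (p i, j))"
    by (rule eq_matI) (auto simp: N_def pn)
  then have "det (mat n n (\<lambda>(i, j). B $$ (p i, p j))) = signof p * det N"
    using det_permute_rows[OF N p] by simp
  also have "det N = det (transpose_mat N)"
    using det_transpose[OF N] by simp
  also have "transpose_mat N = mat n n (\<lambda>(i, j). transpose_mat B $$ (p i, j))"
    by (rule eq_matI) (use B in \<open>auto simp: N_def pn\<close>)
  also have "det \<dots> = signof p * det (transpose_mat B)"
    by (rule det_permute_rows[OF _ p]) (use B in simp)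
  also have "det (transpose_mat B) = det B"
    using det_transpose[OF B] by simp
  also have "signof p * (signof p * det B) = det B"
    by (simp add: sign_def)
  finally show ?thesis .
qed

lemma char_poly_adjacency_matrix_cong:
  assumes vs: "enumerates vs D" and ws: "enumerates ws D"
  shows "char_poly (adjacency_matrix vs D) = char_poly (adjacency_matrix ws D)"
proof -
  have "mset vs = mset ws"
    using vs ws set_eq_iff_mset_eq_distinct[of vs ws] by (simp add: enumerates_def)
  then obtain p where p: "p permutes {..<length ws}" and vs_eq: "permute_list p ws = vs"
    by (rule mset_eq_permutation)
  define n where "n = length ws"
  have len: "length vs = n" using vs_eq by (auto simp: n_def)
  have p': "p permutes {0..<n}" using p by (simp add: n_def lessThan_atLeast0)
  have pn: "p i < n" if "i < n" for i
    using permutes_in_image[OF p', of i] that by simp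
  have pinj: "p i = p j \<longleftrightarrow> i = j" for i j
    using permutes_inj[OF p'] by (auto dest: injD)
  have nth: "vs ! i = ws ! p i" if "i < n" for i
    using that p vs_eq by (auto simp: n_def permute_list_nth)
  let ?W = "char_poly_matrix (adjacency_matrix ws D)"
  have W: "?W \<in> carrier_mat n n"
    by (rule char_poly_matrix_closed) (simp add: adjacency_matrix_def n_def)
  have "char_poly_matrix (adjacency_matrix vs D) = mat n n (\<lambda>(i, j). ?W $$ (p i, p j))"
    by (rule eq_matI)
       (auto simp: char_poly_matrix_def adjacency_matrix_def len n_def[symmetric] nth pn pinj)
  then show ?thesis
    unfolding char_poly_def using det_permute_rows_cols[OF W p'] by simp
qed

lemma eigenvalues_eq:
  assumes "enumerates vs D"
  shows "eigenvalues D = proots (char_poly (adjacency_matrix vs D))"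
  unfolding eigenvalues_def
  by (rule arg_cong[where f = proots], rule char_poly_adjacency_matrix_cong[OF someI assms])
     (rule assms)

lemma size_eigenvalues:
  assumes "finite (pverts D)"
  shows "size (eigenvalues D) = card (pverts D)"
proof -
  obtain vs where vs: "enumerates vs D"
    using finite_distinct_list[OF assms] by (auto simp: enumerates_def)
  then have "length vs = card (pverts D)"
    using distinct_card[of vs] by (simp add: enumerates_def)
  then have "adjacency_matrix vs D \<in> carrier_mat (card (pverts D)) (card (pverts D))"
    by (simp add: adjacency_matrix_def)
  then show ?thesis
    by (simp add: eigenvalues_eq[OF vs] size_proots_complex degree_monic_char_poly)
qed

end

theory Submission
  imports Defs
begin

text \<open>A strong component has strictly fewer reachable vertices than any other component with an arc
  into it, so the vertices can be ordered to make the adjacency matrix block triangular, and the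
  spectrum of \<open>G\<close> is the union of the spectra of its components. With \<open>c = \<sigma> / n\<close> and
  \<open>c\<^sub>i = \<sigma>\<^sub>i / n\<^sub>i\<close> every real \<open>x\<close> satisfies
  \<open>\<bar>x - c\<^sub>i\<bar> \<le> \<bar>x - c\<bar> + (c\<^sub>i - c) + 2 (c - c\<^sub>i) [x > c\<^sub>i]\<close>.
  Summing over the whole spectrum, the terms \<open>c\<^sub>i - c\<close> cancel, which leaves
  \<open>\<Sum>\<^sub>i E(D\<^sub>i) \<le> E(G) + 2 \<Sum>\<^sub>i (c - c\<^sub>i) |B\<^sub>i|\<close>.\<close>

section \<open>Block triangular adjacency matrices and the spectrum of a union of vertex
  sets\<close>

lemma char_poly_four_block_mat_lower_left_zero:
  fixes A :: "'b :: idom mat"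
  assumes A: "A \<in> carrier_mat n n" and B: "B \<in> carrier_mat n m" and C: "C \<in> carrier_mat m m"
  shows "char_poly (four_block_mat A B (0\<^sub>m m n) C) = char_poly A * char_poly C"
proof -
  \<comment> \<open>Passing to the characteristic matrix keeps the zero block, so over the
    polynomial ring the matrix is again block triangular and its determinant factors.\<close>
  have "char_poly_matrix (four_block_mat A B (0\<^sub>m m n) C) =
    four_block_mat (char_poly_matrix A) (map_mat (\<lambda>a. [:- a:]) B) (0\<^sub>m m n) (char_poly_matrix C)"
    by (rule eq_matI) (use A B C in \<open>auto simp: char_poly_matrix_def\<close>)
  then show ?thesis
    unfolding char_poly_def
    by (simp add: det_four_block_mat_lower_left_zero[of _ n _ m] A B C)
qed

text \<open>Characteristic polynomials are monic. Nonzero factors are what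
  \<open>proots_mult\<close> asks for.\<close>

lemma char_poly_nonzero:
  fixes A :: "'b :: comm_ring_1 mat"
  assumes "A \<in> carrier_mat n n"
  shows "char_poly A \<noteq> 0"
  using degree_monic_char_poly[OF assms] by auto

lemma obtain_enumeration:
  assumes "finite (pverts D)"
  obtains vs where "enumerates vs D"
  using finite_distinct_list[OF assms] by (auto simp: enumerates_def)

text \<open>An adjacency matrix only reads arcs between listed vertices. This allows a component to
  be replaced by its vertex set together with the whole arc set of the ambient digraph.\<close>

lemma eigenvalues_cong:
  assumes fin: "finite (pverts D)" and verts: "pverts D = pverts D'"
    and arcs: "\<And>u v. u \<in> pverts D \<Longrightarrow> v \<in> pverts D \<Longrightarrow> (u, v) \<in> parcs D \<longleftrightarrow> (u, v) \<in> parcs D'"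
  shows "eigenvalues D = eigenvalues D'"
proof -
  obtain vs where vs: "enumerates vs D" by (rule obtain_enumeration[OF fin])
  then have vs': "enumerates vs D'" by (simp add: enumerates_def verts)
  have "adjacency_matrix vs D = adjacency_matrix vs D'"
    by (rule eq_matI) (use vs arcs nth_mem[of _ vs] in \<open>simp_all add: adjacency_matrix_def enumerates_def\<close>)
  then show ?thesis by (simp add: eigenvalues_eq[OF vs] eigenvalues_eq[OF vs'])
qed

text \<open>Listing \<open>V\<close> before \<open>U\<close> puts the absent arcs from
  \<open>U\<close> to \<open>V\<close> into the lower left block; arcs from \<open>V\<close> to
  \<open>U\<close> fill the block \<open>X\<close>. All three digraphs share \<open>A\<close>, so
  the lemma can be iterated without restricting arcs.\<close>

lemma eigenvalues_union:
  assumes fin: "finite U" "finite V" and disj: "U \<inter> V = {}"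
    and no_arc: "\<And>u v. u \<in> U \<Longrightarrow> v \<in> V \<Longrightarrow> (u, v) \<notin> A"
  shows "eigenvalues \<lparr>pverts = U \<union> V, parcs = A\<rparr> =
    eigenvalues \<lparr>pverts = U, parcs = A\<rparr> + eigenvalues \<lparr>pverts = V, parcs = A\<rparr>"
    (is "eigenvalues ?UV = eigenvalues ?U + eigenvalues ?V")
proof -
  obtain us where us: "enumerates us ?U" using obtain_enumeration[of ?U] fin by auto
  obtain vs where vs: "enumerates vs ?V" using obtain_enumeration[of ?V] fin by auto
  have vus: "enumerates (vs @ us) ?UV"
    using us vs disj by (auto simp: enumerates_def)
  let ?n = "length vs" and ?m = "length us"
  define X where "X = mat ?n ?m (\<lambda>(i, j). if (vs ! i, us ! j) \<in> A then 1 else (0::complex))"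
  have AV: "adjacency_matrix vs ?V \<in> carrier_mat ?n ?n"
    and AU: "adjacency_matrix us ?U \<in> carrier_mat ?m ?m"
    and X: "X \<in> carrier_mat ?n ?m"
    by (simp_all add: adjacency_matrix_def X_def)
  have zero: "(us ! i, vs ! j) \<notin> A" if "i < ?m" "j < ?n" for i j
    using us vs that by (intro no_arc) (auto simp: enumerates_def)
  have "adjacency_matrix (vs @ us) ?UV =
      four_block_mat (adjacency_matrix vs ?V) X (0\<^sub>m ?m ?n) (adjacency_matrix us ?U)"
    by (rule eq_matI) (auto simp: adjacency_matrix_def X_def nth_append zero)
  then have "char_poly (adjacency_matrix (vs @ us) ?UV) =
      char_poly (adjacency_matrix vs ?V) * char_poly (adjacency_matrix us ?U)"
    using char_poly_four_block_mat_lower_left_zero[OF AV X AU] by simp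
  then show ?thesis
    using char_poly_nonzero[OF AV] char_poly_nonzero[OF AU]
    by (simp add: eigenvalues_eq[OF us] eigenvalues_eq[OF vs] eigenvalues_eq[OF vus] proots_mult
        add.commute)
qed

text \<open>Arcs between different blocks strictly lower \<open>rk\<close>, so a block of least rank
  sends no arc to the others and can be split off. Ranking by \<open>- int (rk i)\<close> makes the
  index inserted last one of least rank.\<close>

lemma eigenvalues_UN:
  fixes C :: "'i \<Rightarrow> 'a set" and rk :: "'i \<Rightarrow> nat"
  assumes "finite I" and "\<And>i. i \<in> I \<Longrightarrow> finite (C i)"
    and "disjoint_family_on C I"
    and "\<And>i j u v. i \<in> I \<Longrightarrow> j \<in> I \<Longrightarrow> i \<noteq> j \<Longrightarrow> u \<in> C i \<Longrightarrow> v \<in> C j \<Longrightarrow> (u, v) \<in> A \<Longrightarrow> rk j < rk i"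
  shows "eigenvalues \<lparr>pverts = (\<Union>i\<in>I. C i), parcs = A\<rparr> =
    (\<Sum>i\<in>I. eigenvalues \<lparr>pverts = C i, parcs = A\<rparr>)"
  using assms
proof (induction I rule: finite_ranking_induct[where f = "\<lambda>i. - int (rk i)"])
  case empty
  have "size (eigenvalues \<lparr>pverts = {} :: 'a set, parcs = A\<rparr>) = 0"
    by (simp add: size_eigenvalues)
  then show ?case by simp
next
  case (insert k I)
  show ?case
  \<comment> \<open>The ranking induction does not promise that the inserted index is new.\<close>
  proof (cases "k \<in> I")
    case True
    then show ?thesis using insert by (simp add: insert_absorb)
  next
    case False
    have no_arc: "(u, v) \<notin> A" if "u \<in> C k" "v \<in> (\<Union>i\<in>I. C i)" for u v
    proof
      assume arc: "(u, v) \<in> A"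
      from that obtain i where i: "i \<in> I" "v \<in> C i" by auto
      have "rk i < rk k"
        by (rule insert.prems(3)[OF _ _ _ that(1) i(2) arc]) (use i False in auto)
      moreover have "rk k \<le> rk i" using insert.hyps(2)[OF i(1)] by simp
      ultimately show False by simp
    qed
    have disj: "C k \<inter> (\<Union>i\<in>I. C i) = {}"
      using insert.prems(2) insert.hyps False by (fastforce simp: disjoint_family_on_def)
    have IH: "eigenvalues \<lparr>pverts = (\<Union>i\<in>I. C i), parcs = A\<rparr> =
        (\<Sum>i\<in>I. eigenvalues \<lparr>pverts = C i, parcs = A\<rparr>)"
    proof (rule insert.IH)
      show "disjoint_family_on C I"
        using insert.prems(2) by (auto simp: disjoint_family_on_def)
      show "rk j < rk i" if "i \<in> I" "j \<in> I" "i \<noteq> j" "u \<in> C i" "v \<in> C j" "(u, v) \<in> A" for i j u v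
        using insert.prems(3)[of i j u v] that by simp
    qed (use insert.prems(1) in auto)
    have "eigenvalues \<lparr>pverts = C k \<union> (\<Union>i\<in>I. C i), parcs = A\<rparr> =
        eigenvalues \<lparr>pverts = C k, parcs = A\<rparr> + eigenvalues \<lparr>pverts = (\<Union>i\<in>I. C i), parcs = A\<rparr>"
      by (rule eigenvalues_union) (use insert.prems(1) insert.hyps(1) disj no_arc in auto)
    then show ?thesis using insert.hyps(1) False IH by simp
  qed
qed

section \<open>Strong components and the spectrum of the whole digraph\<close>

context pair_fin_digraph
begin

text \<open>Through the arc, \<open>S\<close> reaches whatever \<open>T\<close> reaches. The
  inclusion is strict because of \<open>u\<close>: a way back from \<open>T\<close> to
  \<open>u\<close> would merge the two components. The count therefore serves as a rank that
  decreases along arcs between components.\<close>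

lemma card_reachable_scc_less:
  assumes S: "S \<in> sccs_verts" and T: "T \<in> sccs_verts" and "S \<noteq> T"
    and u: "u \<in> S" and v: "v \<in> T" and arc: "(u, v) \<in> parcs G"
  shows "card {w. \<exists>x\<in>T. x \<rightarrow>\<^sup>*\<^bsub>with_proj G\<^esub> w} < card {w. \<exists>x\<in>S. x \<rightarrow>\<^sup>*\<^bsub>with_proj G\<^esub> w}"
proof (rule psubset_card_mono)
  show "finite {w. \<exists>x\<in>S. x \<rightarrow>\<^sup>*\<^bsub>with_proj G\<^esub> w}"
    by (rule finite_subset[of _ "pverts G"])
       (auto dest: reachable_in_verts intro: pair_finite_verts)
  have uv: "u \<rightarrow>\<^sup>*\<^bsub>with_proj G\<^esub> v" using arc by (auto intro: reachable_adjI)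
  have Tv: "v \<rightarrow>\<^sup>*\<^bsub>with_proj G\<^esub> x \<and> x \<rightarrow>\<^sup>*\<^bsub>with_proj G\<^esub> v" if "x \<in> T" for x
    using T v that by (auto simp: in_sccs_verts_conv_reachable)
  \<comment> \<open>Mutual reachability of \<open>u\<close> and \<open>v\<close> would put
    \<open>v\<close> into \<open>S\<close>.\<close>
  have "v \<notin> S" using sccs_verts_disjoint[OF S T \<open>S \<noteq> T\<close>] v by auto
  then have "\<not> v \<rightarrow>\<^sup>*\<^bsub>with_proj G\<^esub> u"
    using S u uv by (auto simp: in_sccs_verts_conv_reachable)
  then have "u \<notin> {w. \<exists>x\<in>T. x \<rightarrow>\<^sup>*\<^bsub>with_proj G\<^esub> w}"
    using Tv by (auto intro: reachable_trans)
  moreover have "u \<rightarrow>\<^sup>*\<^bsub>with_proj G\<^esub> u" using S u by (auto simp: in_sccs_verts_conv_reachable)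
  moreover have "{w. \<exists>x\<in>T. x \<rightarrow>\<^sup>*\<^bsub>with_proj G\<^esub> w} \<subseteq> {w. \<exists>x\<in>S. x \<rightarrow>\<^sup>*\<^bsub>with_proj G\<^esub> w}"
    using Tv uv u by (blast intro: reachable_trans)
  ultimately show "{w. \<exists>x\<in>T. x \<rightarrow>\<^sup>*\<^bsub>with_proj G\<^esub> w} \<subset> {w. \<exists>x\<in>S. x \<rightarrow>\<^sup>*\<^bsub>with_proj G\<^esub> w}"
    using u by blast
qed

lemma eigenvalues_sccs:
  assumes bij: "bij_betw (\<lambda>i. with_proj (D i)) I sccs" and "finite I"
  shows "eigenvalues G = (\<Sum>i\<in>I. eigenvalues (D i))"
proof -
  have scc: "with_proj (D i) \<in> sccs" if "i \<in> I" for i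
    using bij_betw_apply[OF bij that] .
  have sv: "pverts (D i) \<in> sccs_verts" if "i \<in> I" for i
    using in_sccs_vertsI_sccs[OF imageI[OF scc[OF that]]] by simp
  have inj: "i = j" if "i \<in> I" "j \<in> I" "pverts (D i) = pverts (D j)" for i j
  proof -
    have "with_proj (D i) = with_proj (D j)"
      by (rule inj_onD[OF inj_on_verts_sccs]) (simp_all add: that scc)
    then show ?thesis
      using inj_onD[OF bij_betw_imp_inj_on[OF bij] _ that(1,2)] by simp
  qed
  have fin: "finite (pverts (D i))" if "i \<in> I" for i
    using finite_subset[OF sccs_verts_subsets[OF sv[OF that]]] pair_finite_verts by simp
  have cover: "(\<Union>i\<in>I. pverts (D i)) = pverts G"
  proof -
    have "(\<lambda>i. pverts (D i)) ` I = verts ` (\<lambda>i. with_proj (D i)) ` I"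
      by (simp add: image_image)
    also have "\<dots> = sccs_verts"
      by (simp only: bij_betw_imp_surj_on[OF bij] sccs_verts_conv)
    finally have "(\<lambda>i. pverts (D i)) ` I = sccs_verts" .
    moreover have "\<Union>sccs_verts = pverts G"
      using scc_of_in_sccs_verts in_scc_of_self sccs_verts_subsets by blast
    ultimately show ?thesis by simp
  qed
  \<comment> \<open>Strong components are induced subdigraphs, so all blocks may carry the common
    arc set \<open>parcs G\<close>, the form in which \<open>eigenvalues_UN\<close> applies.\<close>
  have D: "eigenvalues \<lparr>pverts = pverts (D i), parcs = parcs G\<rparr> = eigenvalues (D i)"
    if "i \<in> I" for i
  proof (rule eigenvalues_cong)
    have "parcs (D i) = {e \<in> parcs G. fst e \<in> pverts (D i) \<and> snd e \<in> pverts (D i)}"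
      using in_sccs_imp_induced[OF scc[OF that]] by (simp add: induced_subgraph_def)
    then show "(u, v) \<in> parcs \<lparr>pverts = pverts (D i), parcs = parcs G\<rparr> \<longleftrightarrow> (u, v) \<in> parcs (D i)"
      if "u \<in> pverts \<lparr>pverts = pverts (D i), parcs = parcs G\<rparr>"
        "v \<in> pverts \<lparr>pverts = pverts (D i), parcs = parcs G\<rparr>" for u v
      using that by simp
  qed (use fin[OF that] in simp_all)
  have "eigenvalues \<lparr>pverts = (\<Union>i\<in>I. pverts (D i)), parcs = parcs G\<rparr> =
      (\<Sum>i\<in>I. eigenvalues \<lparr>pverts = pverts (D i), parcs = parcs G\<rparr>)"
  proof (rule eigenvalues_UN[where rk = "\<lambda>i. card {w. \<exists>x\<in>pverts (D i). x \<rightarrow>\<^sup>*\<^bsub>with_proj G\<^esub> w}"])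
    show "disjoint_family_on (\<lambda>i. pverts (D i)) I"
      unfolding disjoint_family_on_def
      by (intro ballI impI sccs_verts_disjoint sv) (auto dest: inj)
    fix i j u v
    assume ij: "i \<in> I" "j \<in> I" "i \<noteq> j"
      and arc: "u \<in> pverts (D i)" "v \<in> pverts (D j)" "(u, v) \<in> parcs G"
    from ij have "pverts (D i) \<noteq> pverts (D j)" using inj by auto
    then show "card {w. \<exists>x\<in>pverts (D j). x \<rightarrow>\<^sup>*\<^bsub>with_proj G\<^esub> w} <
        card {w. \<exists>x\<in>pverts (D i). x \<rightarrow>\<^sup>*\<^bsub>with_proj G\<^esub> w}"
      by (rule card_reachable_scc_less[OF sv[OF ij(1)] sv[OF ij(2)] _ arc])
  qed (use \<open>finite I\<close> fin in auto)
  moreover have "\<lparr>pverts = pverts G, parcs = parcs G\<rparr> = G" by simp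
  ultimately show ?thesis using D by (simp add: cover)
qed

end

section \<open>Comparing deviations from two centres, and the energy inequality\<close>

lemma sum_abs_deviation_le:
  fixes x :: "'i \<Rightarrow> real"
  assumes "finite J"
  shows "(\<Sum>j\<in>J. \<bar>x j - d\<bar>) \<le>
    (\<Sum>j\<in>J. \<bar>x j - c\<bar>) + real (card J) * (d - c) + 2 * ((c - d) * real (card {j \<in> J. x j > d}))"
proof -
  have "(\<Sum>j\<in>J. \<bar>x j - d\<bar>) \<le>
      (\<Sum>j\<in>J. \<bar>x j - c\<bar> + (d - c) + (if x j > d then 2 * (c - d) else 0))"
    \<comment> \<open>If \<open>x j \<le> d\<close>, then
      \<open>d - x j = (c - x j) + (d - c)\<close>. Otherwise
      \<open>x j - d = (x j - c) + (c - d)\<close>, and the correction \<open>2 * (c - d)\<close>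
      turns \<open>d - c\<close> into \<open>c - d\<close>.\<close>
    by (rule sum_mono) (auto simp: abs_if)
  also have "\<dots> = (\<Sum>j\<in>J. \<bar>x j - c\<bar>) + real (card J) * (d - c) +
      2 * ((c - d) * real (card {j \<in> J. x j > d}))"
    using assms by (simp add: sum.distrib sum.If_cases Int_def)
  finally show ?thesis .
qed

theorem theorem3p10:
  fixes G :: "'a pair_pre_digraph" and D :: "nat \<Rightarrow> 'a pair_pre_digraph"
    and n \<sigma> k l :: nat and ns \<sigma>s :: "nat \<Rightarrow> nat"
    and ev :: "nat \<Rightarrow> nat \<Rightarrow> complex" and B :: "nat \<Rightarrow> nat set"
  assumes "pair_fin_digraph G" and "pverts G \<noteq> {}"
    and "n = card (pverts G)" and "\<sigma> = card (self_loop_set G)"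
    and "bij_betw (\<lambda>i. with_proj (D i)) {1..k} (pre_digraph.sccs (with_proj G))"
    and "\<And>i. i \<in> {1..k} \<Longrightarrow> ns i = card (pverts (D i))"
    and "\<And>i. i \<in> {1..k} \<Longrightarrow> \<sigma>s i = card (self_loop_set (D i))"
    and "n = (\<Sum>i=1..k. ns i)" and "\<sigma> = (\<Sum>i=1..k. \<sigma>s i)"
    and "\<And>i. i \<in> {1..k} \<Longrightarrow>
           image_mset (ev i) (mset_set {1..ns i}) = eigenvalues (D i)"
    and "1 \<le> l" and "l < k"
    and "\<And>i. i \<in> {1..l} \<Longrightarrow> real (\<sigma>s i) / real (ns i) > real \<sigma> / real n"
    and "\<And>i. i \<in> {l+1..k} \<Longrightarrow> real (\<sigma>s i) / real (ns i) \<le> real \<sigma> / real n"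
    and "\<And>i. i \<in> {1..k} \<Longrightarrow>
           B i = {j \<in> {1..ns i}. Re (ev i j) > real (\<sigma>s i) / real (ns i)}"
  shows "(energy G \<le> (\<Sum>i=1..k. energy (D i)) \<longrightarrow>
            (\<Sum>i=1..l. (real (\<sigma>s i) / real (ns i) - real \<sigma> / real n) * real (card (B i)))
              \<le> (\<Sum>i=l+1..k. (real \<sigma> / real n - real (\<sigma>s i) / real (ns i)) * real (card (B i)))) \<and>
         (energy G < (\<Sum>i=1..k. energy (D i)) \<longrightarrow>
            (\<Sum>i=1..l. (real (\<sigma>s i) / real (ns i) - real \<sigma> / real n) * real (card (B i)))
              < (\<Sum>i=l+1..k. (real \<sigma> / real n - real (\<sigma>s i) / real (ns i)) * real (card (B i))))"
proof -
  interpret pair_fin_digraph G by fact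
  define c where "c = real \<sigma> / real n"
  define d where "d i = real (\<sigma>s i) / real (ns i)" for i
  define b where "b i = real (card (B i))" for i
  have n: "n \<noteq> 0" using assms(2,3) pair_finite_verts by simp
  \<comment> \<open>Components are nonempty, so \<open>d i\<close> is a genuine quotient and
    \<open>real (ns i) * d i\<close> cancels to \<open>real (\<sigma>s i)\<close>.\<close>
  have ns: "ns i \<noteq> 0" if i: "i \<in> {1..k}" for i
  proof -
    have "with_proj (D i) \<in> sccs" using bij_betw_apply[OF assms(5) i] .
    from in_sccs_vertsI_sccs[OF imageI[OF this]] have sv: "pverts (D i) \<in> sccs_verts" by simp
    have "pverts (D i) \<noteq> {}" using sv unfolding in_sccs_verts_conv_reachable by blast
    moreover have "finite (pverts (D i))"
      using finite_subset[OF sccs_verts_subsets[OF sv]] pair_finite_verts by simp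
    ultimately show ?thesis by (simp add: assms(6)[OF i])
  qed
  have energy_D: "energy (D i) = (\<Sum>j=1..ns i. \<bar>Re (ev i j) - d i\<bar>)" if i: "i \<in> {1..k}" for i
    unfolding energy_def assms(10)[OF i, symmetric] assms(6)[OF i, symmetric]
      assms(7)[OF i, symmetric]
    by (simp add: d_def image_mset.compositionality comp_def sum_unfold_sum_mset)
  have sum_mset_sum: "(\<Sum>z\<in>#(\<Sum>i\<in>I. M i). f z) = (\<Sum>i\<in>I. \<Sum>z\<in>#M i. f z)"
    for I :: "nat set" and M :: "nat \<Rightarrow> complex multiset" and f :: "complex \<Rightarrow> real"
    by (induction I rule: infinite_finite_induct) auto
  \<comment> \<open>The spectrum of \<open>G\<close> is regrouped by component, but deviations are
    still measured from the global mean \<open>c\<close>.\<close>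
  have energy_G: "energy G = (\<Sum>i=1..k. \<Sum>j=1..ns i. \<bar>Re (ev i j) - c\<bar>)"
  proof -
    have "energy G = (\<Sum>i=1..k. \<Sum>z\<in>#eigenvalues (D i). \<bar>Re z - c\<bar>)"
      unfolding energy_def assms(3,4)[symmetric] c_def[symmetric]
      by (simp add: eigenvalues_sccs[OF assms(5)] sum_mset_sum)
    also have "\<dots> = (\<Sum>i=1..k. \<Sum>j=1..ns i. \<bar>Re (ev i j) - c\<bar>)"
      by (rule sum.cong[OF refl], subst assms(10)[symmetric])
         (simp_all add: image_mset.compositionality comp_def sum_unfold_sum_mset)
    finally show ?thesis .
  qed
  have "(\<Sum>i=1..k. energy (D i)) \<le> (\<Sum>i=1..k. (\<Sum>j=1..ns i. \<bar>Re (ev i j) - c\<bar>) +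
      real (ns i) * (d i - c) + 2 * ((c - d i) * b i))"
  proof (rule sum_mono)
    fix i assume i: "i \<in> {1..k}"
    then show "energy (D i) \<le> (\<Sum>j=1..ns i. \<bar>Re (ev i j) - c\<bar>) +
      real (ns i) * (d i - c) + 2 * ((c - d i) * b i)"
      using sum_abs_deviation_le[of "{1..ns i}" "\<lambda>j. Re (ev i j)" "d i" c]
      by (simp only: energy_D b_def assms(15) d_def[symmetric]) simp
  qed
  also have "\<dots> = energy G + (\<Sum>i=1..k. real (ns i) * (d i - c)) + 2 * (\<Sum>i=1..k. (c - d i) * b i)"
    by (simp add: energy_G sum.distrib sum_distrib_left)
  \<comment> \<open>Weighted by the orders, the local means \<open>d i\<close> average to
    \<open>c\<close>, so the linear terms cancel.\<close>
  also have "(\<Sum>i=1..k. real (ns i) * (d i - c)) = (\<Sum>i=1..k. real (\<sigma>s i) - real (ns i) * c)"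
    using ns by (intro sum.cong) (auto simp: d_def algebra_simps)
  also have "\<dots> = real \<sigma> - real n * c"
    by (simp add: assms(8,9) sum_subtractf sum_distrib_right)
  also have "\<dots> = 0" using n by (simp add: c_def)
  finally have key: "(\<Sum>i=1..k. energy (D i)) \<le> energy G + 2 * (\<Sum>i=1..k. (c - d i) * b i)"
    by simp
  \<comment> \<open>By \<open>key\<close>, the energy gap is at most twice the right side minus the
    left side of the claim, once the terms up to \<open>l\<close> change sign. A nonnegative gap
    gives the weak inequality, a positive gap the strict one.\<close>
  have "{1..k} = {1..l} \<union> {l+1..k}" "{1..l} \<inter> {l+1..k} = {}" using assms(12) by auto
  then have "(\<Sum>i=1..k. (c - d i) * b i) = (\<Sum>i=1..l. (c - d i) * b i) + (\<Sum>i=l+1..k. (c - d i) * b i)"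
    by (simp only: sum.union_disjoint finite_atLeastAtMost)
  moreover have "(\<Sum>i=1..l. (c - d i) * b i) = - (\<Sum>i=1..l. (d i - c) * b i)"
    by (simp add: sum_negf[symmetric] algebra_simps)
  ultimately show ?thesis
    using key unfolding c_def[symmetric] d_def[symmetric] b_def[symmetric] by linarith
qed

end
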